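(* Let $n\ge 1$, $d>0$, let $k:\mathbb R^n\to\mathbb R$ satisfy $k\in C(\mathbb R^n)\cap L^\infty(\mathbb R^n)$, $k\ge 0$, $k(0)>0$, $\int_{\mathbb R^n}k(x)\,dx=1$, and assume in addition that $k$ is radially symmetric and decreasing in $|x|$. Let $\Omega_0$ be a smooth bounded domain in $\mathbb R^n$ such that $\bar\Omega_0$ is convex, $\ell_0>0$ a constant, and let $\gamma_0\in L^\infty(\mathbb R^n)$ satisfy $\gamma_0(x)=-\ell_0$ for $x\in\mathbb R^n\setminus\bar\Omega_0$, $\gamma_0|_{\bar\Omega_0}\ge 0$, $\gamma_0|_{\bar\Omega_0}\not\equiv 0$, and $\gamma_0|_{\bar\Omega_0}\in C(\bar\Omega_0)$. Let $\gamma$ be the solution of $$\begin{cases}\displaystyle \gamma_t(t,x)=d\int_{\{\gamma>0\}}k(x-y)\gamma(t,y)\,dy-d\,\gamma(t,x)\chi_{\{\gamma>0\}}, & t>0,\ x\in\mathbb R^n,\\ \gamma(0,x)=\gamma_0(x), & x\in\mathbb R^n,\end{cases}$$ and set $\Omega(t)=\{x\in\mathbb R^n:\gamma(t,x)\ge0\}$. Then $\Omega(t)$ expands continuously, i.e. no jumping phenomenon occurs: $\Omega(t)$ is connected for every $t\ge0$.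
   Context: $\chi_E$ is the characteristic function of $E$; $\{\gamma>0\}$ at time $t$ means $\{y:\gamma(t,y)>0\}$. The problem has a unique global solution $\gamma\in C([0,\infty);L^\infty(\mathbb R^n))$, in the sense of the time-integrated equation $\gamma(t,x)=\gamma_0(x)+d\int_0^t\int_{\{\gamma(\tau,\cdot)>0\}}k(x-y)\gamma(\tau,y)\,dy\,d\tau-d\int_0^t\gamma(\tau,x)\chi_{\{\gamma>0\}}(\tau,x)\,d\tau$; $\gamma(t,\cdot)$ is taken to be the representative satisfying this equation for every $x$, which is continuous on $\bar\Omega_0$ and on $\mathbb R^n\setminus\bar\Omega_0$. The jumping phenomenon (discontinuous expansion) means that $\Omega(t)$ becomes disconnected at some time. *)

theory Defs
  imports "HOL-Analysis.Analysis" "HOL-Probability.Essential_Supremum"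
begin

definition Linfty_norm :: "('a::euclidean_space \<Rightarrow> real) \<Rightarrow> ereal" where
  "Linfty_norm f = esssup lebesgue (\<lambda>x. ereal \<bar>f x\<bar>)"

definition in_Linfty :: "('a::euclidean_space \<Rightarrow> real) \<Rightarrow> bool" where
  "in_Linfty f \<longleftrightarrow> f \<in> borel_measurable lebesgue \<and> Linfty_norm f < \<infinity>"

text \<open>Membership in \<open>C([0,\<infinity>); L\<^sup>\<infinity>)\<close>; values at negative times are irrelevant.\<close>

definition continuous_into_Linfty :: "(real \<Rightarrow> 'a::euclidean_space \<Rightarrow> real) \<Rightarrow> bool" where
  "continuous_into_Linfty u \<longleftrightarrow>
     (\<forall>t\<ge>0. in_Linfty (u t)) \<and>
     (\<forall>t\<ge>0. ((\<lambda>s. Linfty_norm (\<lambda>x. u s x - u t x)) \<longlongrightarrow> 0) (at t within {0..}))"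

text \<open>\<open>Ck_on m S f\<close> means that \<open>f\<close> is of class \<open>C\<^sup>m\<close> on \<open>S\<close>; it is only meaningful for
  open \<open>S\<close>, since \<open>frechet_derivative\<close> is taken at \<open>x\<close> without restriction to \<open>S\<close>.\<close>

primrec Ck_on :: "nat \<Rightarrow> 'a::euclidean_space set \<Rightarrow> ('a \<Rightarrow> real) \<Rightarrow> bool" where
  "Ck_on 0 S f \<longleftrightarrow> continuous_on S f"
| "Ck_on (Suc m) S f \<longleftrightarrow>
     f differentiable_on S \<and> (\<forall>b\<in>Basis. Ck_on m S (\<lambda>x. frechet_derivative f (at x) b))"

definition smooth_function_on :: "'a::euclidean_space set \<Rightarrow> ('a \<Rightarrow> real) \<Rightarrow> bool" where
  "smooth_function_on S f \<longleftrightarrow> (\<forall>m. Ck_on m S f)"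

text \<open>Near each boundary point the domain is the strict sublevel set of a smooth function
  without critical points, so it lies locally on one side of its boundary.\<close>

definition smooth_boundary :: "'a::euclidean_space set \<Rightarrow> bool" where
  "smooth_boundary S \<longleftrightarrow>
     (\<forall>p\<in>frontier S. \<exists>U \<phi>. open U \<and> p \<in> U \<and> smooth_function_on U \<phi> \<and>
        (\<forall>x\<in>U. frechet_derivative \<phi> (at x) \<noteq> (\<lambda>v. 0)) \<and>
        S \<inter> U = {x\<in>U. \<phi> x < 0})"

definition smooth_bounded_domain :: "'a::euclidean_space set \<Rightarrow> bool" where
  "smooth_bounded_domain S \<longleftrightarrow>
     open S \<and> connected S \<and> S \<noteq> {} \<and> bounded S \<and> smooth_boundary S"

text \<open>The equation is imposed for every \<open>x\<close>, not just almost every \<open>x\<close>: this fixes the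
  pointwise representative of \<open>\<gamma> t\<close>. Integrability in time is demanded explicitly because a
  non-integrable function has integral \<open>0\<close> by convention; the inner integral always exists
  for integrable \<open>k\<close> and essentially bounded \<open>\<gamma> \<tau>\<close>.\<close>

definition nonlocal_solution ::
  "real \<Rightarrow> ('a::euclidean_space \<Rightarrow> real) \<Rightarrow> ('a \<Rightarrow> real) \<Rightarrow> (real \<Rightarrow> 'a \<Rightarrow> real) \<Rightarrow> bool" where
  "nonlocal_solution d k \<gamma>0 \<gamma> \<longleftrightarrow>
     continuous_into_Linfty \<gamma> \<and>
     (\<forall>t\<ge>0. \<forall>x.
        set_integrable lebesgue {0..t}
          (\<lambda>\<tau>. LINT y:{y. \<gamma> \<tau> y > 0}|lebesgue. k (x - y) * \<gamma> \<tau> y) \<and>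
        set_integrable lebesgue {0..t}
          (\<lambda>\<tau>. \<gamma> \<tau> x * indicat_real {y. \<gamma> \<tau> y > 0} x) \<and>
        \<gamma> t x = \<gamma>0 x
          + d * (LINT \<tau>:{0..t}|lebesgue.
                   (LINT y:{y. \<gamma> \<tau> y > 0}|lebesgue. k (x - y) * \<gamma> \<tau> y))
          - d * (LINT \<tau>:{0..t}|lebesgue. \<gamma> \<tau> x * indicat_real {y. \<gamma> \<tau> y > 0} x))"

end

theory Submission
  imports Defs
begin

text \<open>The set \<open>{x. \<gamma> t x \<ge> 0}\<close> is a union of segments, each joining one of its points to the convex
set \<open>closure \<Omega>0\<close>, and is therefore connected. The segments come from a reflection argument.

Let \<open>R\<close> be the reflection in a hyperplane that has \<open>closure \<Omega>0\<close> strictly on one side, and let \<open>H\<close>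
be the open half-space on that side. Points of \<open>R ` H\<close> start at the minimal value \<open>- l0\<close>, so
\<open>w t z = \<gamma> t z - \<gamma> t (R z)\<close> is nonnegative on \<open>H\<close> at time \<open>0\<close>. This persists
(\<open>reflection_comparison\<close>). The nonlocal terms of the equations at \<open>z\<close> and at \<open>R z\<close> differ by
\<open>\<integral>\<^bsub>H\<^esub> (k (z - y) - k (R z - y)) (u y - u (R y)) dy\<close> with \<open>u\<close> the positive part of \<open>\<gamma>\<close>, and the
kernel here is nonnegative, because a point of \<open>H\<close> is closer to \<open>z\<close> than to \<open>R z\<close>. Hence if
\<open>w \<ge> - N\<close> at some time, the two nonlocal terms differ by at least \<open>- N\<close>, while the local term
can only increase \<open>w\<close> wherever \<open>w < 0\<close>. Measured with the weight \<open>exp (2 d t)\<close>, the negative part of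
\<open>w\<close> is thus at most half of any bound known for it, so it vanishes
(\<open>reflection_defect_halving\<close>).

Now take \<open>x\<close> with \<open>\<gamma> t x \<ge> 0\<close>, its closest point \<open>p\<close> in \<open>closure \<Omega>0\<close>, and \<open>y\<close> on the segment
from \<open>p\<close> to \<open>x\<close>. The perpendicular bisector of \<open>y\<close> and \<open>x\<close> leaves \<open>closure \<Omega>0\<close> on the side
of \<open>y\<close> by convexity, and comparison across it gives \<open>\<gamma> t y \<ge> \<gamma> t x \<ge> 0\<close>.\<close>

section \<open>Lebesgue measure is invariant under isometries\<close>

lemma nn_integral_lborel_translate:
  fixes f :: "'a::euclidean_space \<Rightarrow> ennreal"
  assumes [measurable]: "f \<in> borel_measurable borel"
  shows "(\<integral>\<^sup>+x. f (c + x) \<partial>lborel) = (\<integral>\<^sup>+x. f x \<partial>lborel)"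
  by (subst (2) lborel_distr_plus[symmetric, of c]) (simp add: nn_integral_distr)

text \<open>The usual uniqueness proof for Haar measure. Write \<open>\<lambda>\<close> for Lebesgue measure and \<open>\<mu>\<close> for its image
under \<open>L\<close>, which is again translation invariant. With the unit ball \<open>A\<close> and a Borel set \<open>B\<close>,
computing the integral of \<open>1\<^bsub>A\<^esub>(x) 1\<^bsub>B\<^esub>(x + L y)\<close> in both orders shows
\<open>\<lambda>(A) \<mu>(B) = \<lambda>(A) \<lambda>(B)\<close>. The ball is the right test set because \<open>L\<close> preserves it.\<close>

lemma distr_lborel_orthogonal_transformation:
  fixes L :: "'a::euclidean_space \<Rightarrow> 'a"
  assumes L: "orthogonal_transformation L"
  shows "distr lborel borel L = lborel"
proof (rule measure_eqI)
  let ?A = "ball 0 1 :: 'a set"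
  have lin: "linear L" and nrm: "norm (L x) = norm x" for x
    using L by (auto simp: orthogonal_transformation)
  have bij: "bij L"
    using L by (rule orthogonal_transformation_bij)
  have inv: "L (inv L x) = x" for x
    using bij by (simp add: bij_is_surj surj_f_inv_f)
  have [measurable]: "L \<in> borel_measurable borel"
    using lin by (intro borel_measurable_continuous_onI linear_continuous_on) (simp add: linear_conv_bounded_linear)
  have [measurable]: "?A \<in> sets borel" by simp
  fix B assume "B \<in> sets (distr lborel borel L)"
  then have [measurable]: "B \<in> sets borel" by simp
  let ?a = "indicator ?A :: 'a \<Rightarrow> ennreal" and ?b = "indicator B :: 'a \<Rightarrow> ennreal"
  have ball: "(\<integral>\<^sup>+y. ?a (x - L y) \<partial>lborel) = emeasure lborel ?A" for x
  proof -
    have "?a (x - L y) = ?a (- inv L x + y)" for y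
    proof -
      have "x - L y = - L (- inv L x + y)"
        using lin by (simp add: linear_add linear_neg linear_diff inv)
      then have "norm (x - L y) = norm (- inv L x + y)"
        by (metis norm_minus_cancel nrm)
      then show ?thesis by (simp add: indicator_def)
    qed
    then have "(\<integral>\<^sup>+y. ?a (x - L y) \<partial>lborel) = (\<integral>\<^sup>+y. ?a (- inv L x + y) \<partial>lborel)"
      by presburger
    also have "\<dots> = emeasure lborel ?A"
      by (subst nn_integral_lborel_translate) simp_all
    finally show ?thesis .
  qed
  have "emeasure lborel ?A * emeasure (distr lborel borel L) B
      = (\<integral>\<^sup>+x. ?a x * (\<integral>\<^sup>+y. ?b (L y) \<partial>lborel) \<partial>lborel)"
  proof -
    have "emeasure (distr lborel borel L) B = (\<integral>\<^sup>+y. ?b y \<partial>distr lborel borel L)"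
      by simp
    also have "\<dots> = (\<integral>\<^sup>+y. ?b (L y) \<partial>lborel)"
      by (rule nn_integral_distr) simp_all
    finally have "emeasure (distr lborel borel L) B = (\<integral>\<^sup>+y. ?b (L y) \<partial>lborel)" .
    then show ?thesis
      by (simp only:) (subst nn_integral_multc, simp_all)
  qed
  also have "\<dots> = (\<integral>\<^sup>+x. (\<integral>\<^sup>+y. ?a x * ?b (x + L y) \<partial>lborel) \<partial>lborel)"
  proof (intro nn_integral_cong)
    fix x
    have "(\<integral>\<^sup>+y. ?b (L y) \<partial>lborel) = (\<integral>\<^sup>+y. ?b (L (inv L x + y)) \<partial>lborel)"
      by (rule nn_integral_lborel_translate[where f = "\<lambda>y. ?b (L y)", symmetric]) simp
    also have "\<dots> = (\<integral>\<^sup>+y. ?b (x + L y) \<partial>lborel)"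
      using lin by (simp add: linear_add inv)
    finally show "?a x * (\<integral>\<^sup>+y. ?b (L y) \<partial>lborel) = (\<integral>\<^sup>+y. ?a x * ?b (x + L y) \<partial>lborel)"
      by (simp add: nn_integral_cmult)
  qed
  also have "\<dots> = (\<integral>\<^sup>+y. (\<integral>\<^sup>+x. ?a x * ?b (x + L y) \<partial>lborel) \<partial>lborel)"
    by (rule lborel_pair.Fubini') simp
  also have "\<dots> = (\<integral>\<^sup>+y. (\<integral>\<^sup>+x. ?a (x - L y) * ?b x \<partial>lborel) \<partial>lborel)"
  proof (rule nn_integral_cong)
    fix y
    show "(\<integral>\<^sup>+x. ?a x * ?b (x + L y) \<partial>lborel) = (\<integral>\<^sup>+x. ?a (x - L y) * ?b x \<partial>lborel)"
      using nn_integral_lborel_translate[of "\<lambda>x. ?a (x - L y) * ?b x" "L y"]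
      by (simp add: add.commute)
  qed
  also have "\<dots> = (\<integral>\<^sup>+x. (\<integral>\<^sup>+y. ?a (x - L y) * ?b x \<partial>lborel) \<partial>lborel)"
    by (rule lborel_pair.Fubini') simp
  also have "\<dots> = (\<integral>\<^sup>+x. emeasure lborel ?A * ?b x \<partial>lborel)"
    by (simp add: nn_integral_multc ball)
  also have "\<dots> = emeasure lborel ?A * emeasure lborel B"
    by (simp add: nn_integral_cmult)
  finally have "emeasure lborel ?A * emeasure (distr lborel borel L) B = emeasure lborel ?A * emeasure lborel B" .
  moreover have "emeasure lborel ?A \<noteq> 0"
  proof
    assume "emeasure lborel ?A = 0"
    then have "measure lborel ?A = 0" by (simp only: measure_def enn2real_0)
    then show False using content_ball_pos[of 1 "0::'a"] by simp
  qed
  moreover have "emeasure lborel ?A \<noteq> \<infinity>"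
    using emeasure_lborel_ball_finite[of "0::'a" 1] by simp
  ultimately show "emeasure (distr lborel borel L) B = emeasure lborel B"
    by (simp add: ennreal_mult_cancel_left)
qed simp

text \<open>An isometry of Euclidean space is a translation after an orthogonal map. The result for
Borel sets passes to the completed measure because preimages of Borel null sets are null sets.\<close>

lemma
  fixes \<phi> :: "'a::euclidean_space \<Rightarrow> 'a"
  assumes iso: "\<And>x y. dist (\<phi> x) (\<phi> y) = dist x y"
  shows isometry_lebesgue_measurable: "\<phi> \<in> lebesgue \<rightarrow>\<^sub>M lebesgue"
    and distr_lebesgue_isometry: "distr lebesgue lebesgue \<phi> = lebesgue"
proof -
  define L where "L x = \<phi> x - \<phi> 0" for x
  have L: "orthogonal_transformation L"
    unfolding orthogonal_transformation_isometry using iso by (simp add: L_def dist_norm)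
  have \<phi>: "\<phi> = (+) (\<phi> 0) \<circ> L"
    by (auto simp: L_def)
  have Lb: "L \<in> borel_measurable borel"
    using L by (intro borel_measurable_continuous_onI linear_continuous_on)
      (simp add: linear_conv_bounded_linear orthogonal_transformation)
  then have meas: "\<phi> \<in> borel \<rightarrow>\<^sub>M borel"
    by (subst \<phi>) (simp add: comp_def)
  have "distr lborel borel \<phi> = distr (distr lborel borel L) borel ((+) (\<phi> 0))"
    using Lb by (subst \<phi>, subst distr_distr) auto
  also have "\<dots> = lborel"
    by (simp add: distr_lborel_orthogonal_transformation[OF L] lborel_distr_plus)
  finally have *: "distr lborel borel \<phi> = lborel" .
  then have **: "distr lebesgue lborel \<phi> = lborel"
    using meas by (simp add: distr_completion cong: distr_cong)
  show "\<phi> \<in> lebesgue \<rightarrow>\<^sub>M lebesgue"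
    using meas by (intro completion.measurable_completion2) (auto simp: ** intro!: measurable_completion)
  show "distr lebesgue lebesgue \<phi> = lebesgue"
    using completion.completion_distr_eq[of \<phi> lborel lborel] meas
    by (simp add: ** measurable_completion)
qed

section \<open>Convolutions and reflections in a hyperplane\<close>

text \<open>For a unit vector \<open>e\<close>, the reflection in the hyperplane \<open>{z. z \<bullet> e = c}\<close>.\<close>

definition hyperplane_reflection :: "'a::real_inner \<Rightarrow> real \<Rightarrow> 'a \<Rightarrow> 'a" where
  "hyperplane_reflection e c x = x - (2 * (x \<bullet> e - c)) *\<^sub>R e"

lemma inner_hyperplane_reflection:
  "norm e = 1 \<Longrightarrow> hyperplane_reflection e c x \<bullet> e = 2 * c - x \<bullet> e"
  by (simp add: hyperplane_reflection_def inner_diff_left norm_eq_1)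

lemma hyperplane_reflection_involution:
  assumes "norm e = 1"
  shows "hyperplane_reflection e c (hyperplane_reflection e c x) = x"
proof -
  have "hyperplane_reflection e c (hyperplane_reflection e c x)
      = hyperplane_reflection e c x - (2 * (2 * c - x \<bullet> e - c)) *\<^sub>R e"
    by (subst hyperplane_reflection_def) (simp only: inner_hyperplane_reflection[OF assms])
  also have "\<dots> = x - (2 * (x \<bullet> e - c) + 2 * (2 * c - x \<bullet> e - c)) *\<^sub>R e"
    unfolding hyperplane_reflection_def scaleR_left_distrib by simp
  also have "\<dots> = x" by simp
  finally show ?thesis .
qed

lemma dist_hyperplane_reflection:
  assumes "norm e = 1"
  shows "dist (hyperplane_reflection e c x) (hyperplane_reflection e c y) = dist x y"
proof -
  have "hyperplane_reflection e c x - hyperplane_reflection e c y = (x - y) - (2 * ((x - y) \<bullet> e)) *\<^sub>R e"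
    by (simp add: hyperplane_reflection_def inner_diff_left algebra_simps)
  moreover have "norm (v - (2 * (v \<bullet> e)) *\<^sub>R e) = norm v" for v
  proof -
    have "(v - (2 * (v \<bullet> e)) *\<^sub>R e) \<bullet> (v - (2 * (v \<bullet> e)) *\<^sub>R e) = v \<bullet> v"
      using assms by (simp add: norm_eq_1 inner_diff inner_commute[of e v] algebra_simps)
    then show ?thesis by (simp add: norm_eq_sqrt_inner)
  qed
  ultimately show ?thesis by (simp add: dist_norm)
qed

lemma dist_hyperplane_reflection_swap:
  assumes "norm e = 1"
  shows "dist (hyperplane_reflection e c x) y = dist x (hyperplane_reflection e c y)"
  using dist_hyperplane_reflection[OF assms, of c x "hyperplane_reflection e c y"]
  by (simp only: hyperplane_reflection_involution[OF assms])

text \<open>The added term is nonnegative when \<open>x\<close> and \<open>y\<close> lie on the same side of the hyperplane, so \<open>y\<close> is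
then closer to \<open>x\<close> than to the mirror image of \<open>x\<close>.\<close>

lemma dist_hyperplane_reflection_squared:
  assumes "norm e = 1"
  shows "(dist (hyperplane_reflection e c x) y)\<^sup>2 = (dist x y)\<^sup>2 + 4 * (c - x \<bullet> e) * (c - y \<bullet> e)"
proof -
  define s where "s = 2 * (x \<bullet> e - c)"
  have "(dist (hyperplane_reflection e c x) y)\<^sup>2 = ((x - y) - s *\<^sub>R e) \<bullet> ((x - y) - s *\<^sub>R e)"
  proof -
    have "hyperplane_reflection e c x - y = (x - y) - s *\<^sub>R e"
      by (simp add: hyperplane_reflection_def s_def)
    then show ?thesis by (simp only: dist_norm power2_norm_eq_inner)
  qed
  also have "\<dots> = (x - y) \<bullet> (x - y) - 2 * s * ((x - y) \<bullet> e) + s * s * (e \<bullet> e)"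
  proof -
    have "(v - s *\<^sub>R e) \<bullet> (v - s *\<^sub>R e) = v \<bullet> v - 2 * s * (v \<bullet> e) + s * s * (e \<bullet> e)" for v
      by (simp add: inner_diff_left inner_diff_right inner_commute[of e v] algebra_simps)
    then show ?thesis .
  qed
  also have "\<dots> = (dist x y)\<^sup>2 + 4 * (c - x \<bullet> e) * (c - y \<bullet> e)"
    using assms by (simp add: norm_eq_1 s_def dist_norm power2_norm_eq_inner inner_diff_left algebra_simps)
  finally show ?thesis .
qed

lemma
  fixes f :: "'a::euclidean_space \<Rightarrow> real"
  assumes f: "integrable lebesgue f"
  shows lebesgue_integrable_reflect_point: "integrable lebesgue (\<lambda>y. f (x - y))"
    and lebesgue_integral_reflect_point: "(LINT y|lebesgue. f (x - y)) = (LINT y|lebesgue. f y)"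
proof -
  have iso: "dist (x - y) (x - z) = dist y z" for y z
    by (simp add: dist_norm norm_minus_commute)
  note meas = isometry_lebesgue_measurable[OF iso] and distr = distr_lebesgue_isometry[OF iso]
  show "integrable lebesgue (\<lambda>y. f (x - y))"
    using integrable_distr[OF meas] f distr by metis
  show "(LINT y|lebesgue. f (x - y)) = (LINT y|lebesgue. f y)"
    using integral_distr[OF meas] f distr by (metis borel_measurable_integrable)
qed

lemma integrable_convolution_integrand:
  fixes k u :: "'a::euclidean_space \<Rightarrow> real"
  assumes k: "integrable lebesgue k"
    and u: "u \<in> borel_measurable lebesgue" and u_le: "AE y in lebesgue. \<bar>u y\<bar> \<le> C"
  shows "integrable lebesgue (\<lambda>y. k (x - y) * u y)"
proof (rule Bochner_Integration.integrable_bound[where f = "\<lambda>y. C * k (x - y)"])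
  note k_shift = lebesgue_integrable_reflect_point[OF k, of x]
  show "integrable lebesgue (\<lambda>y. C * k (x - y))" using k_shift by simp
  show "(\<lambda>y. k (x - y) * u y) \<in> borel_measurable lebesgue"
    using borel_measurable_integrable[OF k_shift] u by (rule borel_measurable_times)
  show "AE y in lebesgue. norm (k (x - y) * u y) \<le> norm (C * k (x - y))"
    using u_le
  proof eventually_elim
    case (elim y)
    then have "\<bar>u y\<bar> * \<bar>k (x - y)\<bar> \<le> \<bar>C\<bar> * \<bar>k (x - y)\<bar>"
      by (intro mult_right_mono) auto
    then show ?case by (simp add: abs_mult mult.commute)
  qed
qed

text \<open>With \<open>\<delta> y = k (x - y) - k (R x - y)\<close>, the difference in question is the integral of \<open>\<delta> u\<close>. Since
\<open>\<delta>\<close> is odd under \<open>R\<close>, symmetrizing gives twice this integral as that of \<open>\<delta> y (u y - u (R y))\<close>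
over the whole space. Both factors change sign under \<open>R\<close>, and on the side of \<open>x\<close> the first is
nonnegative and the second at least \<open>- N\<close>, so the product is at least \<open>- N \<bar>\<delta>\<bar>\<close> everywhere;
and \<open>\<bar>\<delta> y\<bar>\<close> is dominated by \<open>k (x - y) + k (R x - y)\<close>, which has mass \<open>2\<close>.\<close>

lemma reflected_convolution_lower_bound:
  fixes k u :: "'a::euclidean_space \<Rightarrow> real"
  assumes k: "integrable lebesgue k" and k_nonneg: "\<And>x. k x \<ge> 0" and k1: "(LINT x|lebesgue. k x) = 1"
    and k_decreasing: "\<And>x y. norm x \<le> norm y \<Longrightarrow> k y \<le> k x"
    and u: "u \<in> borel_measurable lebesgue" and u_le: "AE y in lebesgue. \<bar>u y\<bar> \<le> C"
    and e: "norm e = 1"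
    and N: "N \<ge> 0" and lower: "\<And>y. y \<bullet> e < c \<Longrightarrow> - N \<le> u y - u (hyperplane_reflection e c y)"
    and x: "x \<bullet> e < c"
  shows "- N \<le> (LINT y|lebesgue. k (x - y) * u y)
               - (LINT y|lebesgue. k (hyperplane_reflection e c x - y) * u y)"
proof -
  let ?R = "hyperplane_reflection e c"
  have radial: "k v = k w" if "norm v = norm w" for v w
    using k_decreasing[of v w] k_decreasing[of w v] that by simp
  note iso = dist_hyperplane_reflection[OF e, of c]
  note Rm = isometry_lebesgue_measurable[OF iso] and Rd = distr_lebesgue_isometry[OF iso]
  define \<delta> where "\<delta> y = k (x - y) - k (?R x - y)" for y
  have int: "integrable lebesgue (\<lambda>y. \<delta> y * u y)"
    unfolding \<delta>_def left_diff_distrib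
    by (intro Bochner_Integration.integrable_diff integrable_convolution_integrand[OF k u u_le])
  have diff: "(LINT y|lebesgue. k (x - y) * u y) - (LINT y|lebesgue. k (?R x - y) * u y) = (LINT y|lebesgue. \<delta> y * u y)"
    unfolding \<delta>_def left_diff_distrib
    by (intro Bochner_Integration.integral_diff[symmetric] integrable_convolution_integrand[OF k u u_le])
  have kR: "k (x - ?R y) = k (?R x - y)" "k (?R x - ?R y) = k (x - y)" for y
    using dist_hyperplane_reflection_swap[OF e, of c x y] iso[of x y]
    by (auto intro!: radial simp: dist_norm)
  have odd: "\<delta> (?R y) = - \<delta> y" for y
    by (simp add: \<delta>_def kR)
  have intR: "integrable lebesgue (\<lambda>y. \<delta> y * u (?R y))"
    and "(LINT y|lebesgue. \<delta> y * u y) = - (LINT y|lebesgue. \<delta> y * u (?R y))"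
  proof -
    have "integrable lebesgue (\<lambda>y. \<delta> (?R y) * u (?R y))"
      using integrable_distr[OF Rm, of "\<lambda>y. \<delta> y * u y"] int by (simp add: Rd)
    then show "integrable lebesgue (\<lambda>y. \<delta> y * u (?R y))" by (simp add: odd)
    have "(LINT y|lebesgue. \<delta> y * u y) = (LINT y|lebesgue. \<delta> (?R y) * u (?R y))"
      using integral_distr[OF Rm, of "\<lambda>y. \<delta> y * u y"] int by (simp add: Rd)
    then show "(LINT y|lebesgue. \<delta> y * u y) = - (LINT y|lebesgue. \<delta> y * u (?R y))"
      by (simp add: odd)
  qed
  then have twice: "2 * (LINT y|lebesgue. \<delta> y * u y) = (LINT y|lebesgue. \<delta> y * (u y - u (?R y)))"
    using int by (simp add: right_diff_distrib)
  have sign: "0 \<le> \<delta> y" if "y \<bullet> e \<le> c" for y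
  proof -
    have "(dist x y)\<^sup>2 \<le> (dist (?R x) y)\<^sup>2"
      using that x by (simp add: dist_hyperplane_reflection_squared[OF e])
    then have "dist x y \<le> dist (?R x) y"
      by (rule power2_le_imp_le) simp
    then have "k (?R x - y) \<le> k (x - y)"
      by (intro k_decreasing) (simp add: dist_norm)
    then show ?thesis by (simp add: \<delta>_def)
  qed
  have pointwise: "- N * (k (x - y) + k (?R x - y)) \<le> \<delta> y * (u y - u (?R y))" for y
  proof -
    have half: "- N * (k (x - y) + k (?R x - y)) \<le> \<delta> y * (u y - u (?R y))" if y: "y \<bullet> e < c" for y
    proof -
      have "\<delta> y \<le> k (x - y) + k (?R x - y)"
        using k_nonneg[of "?R x - y"] by (simp add: \<delta>_def)
      then have "N * \<delta> y \<le> N * (k (x - y) + k (?R x - y))"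
        using N by (rule mult_left_mono)
      moreover have "\<delta> y * (- N) \<le> \<delta> y * (u y - u (?R y))"
        using lower[OF y] sign[of y] y by (intro mult_left_mono) auto
      ultimately show ?thesis by (simp add: mult.commute)
    qed
    consider "y \<bullet> e < c" | "y \<bullet> e = c" | "?R y \<bullet> e < c"
      unfolding inner_hyperplane_reflection[OF e] by linarith
    then show ?thesis
    proof cases
      case 1
      then show ?thesis by (rule half)
    next
      case 2
      then have "?R y = y" by (simp add: hyperplane_reflection_def)
      then show ?thesis using N k_nonneg by simp
    next
      case 3
      have "- N * (k (?R x - y) + k (x - y)) \<le> - \<delta> y * (u (?R y) - u y)"
        using half[OF 3] by (simp only: kR odd hyperplane_reflection_involution[OF e])
      also have "- \<delta> y * (u (?R y) - u y) = \<delta> y * (u y - u (?R y))"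
        by (simp add: right_diff_distrib)
      finally show ?thesis by (simp only: add.commute)
    qed
  qed
  note intk = lebesgue_integrable_reflect_point[OF k]
  have "- 2 * N = (LINT y|lebesgue. - N * (k (x - y) + k (?R x - y)))"
    using intk by (simp add: lebesgue_integral_reflect_point[OF k] k1)
  also have "\<dots> \<le> (LINT y|lebesgue. \<delta> y * (u y - u (?R y)))"
  proof (rule integral_mono)
    show "integrable lebesgue (\<lambda>y. - N * (k (x - y) + k (?R x - y)))"
      using intk by simp
    show "integrable lebesgue (\<lambda>y. \<delta> y * (u y - u (?R y)))"
      using int intR by (simp add: right_diff_distrib)
  qed (rule pointwise)
  finally show ?thesis using twice diff by linarith
qed

section \<open>An integral inequality in time\<close>

text \<open>The bound on the growth rate \<open>h\<close> is available only while \<open>g < 0\<close>. This suffices: integrate from the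
last time \<open>s\<close> before \<open>t\<close> with \<open>g s \<ge> 0\<close>, which exists because \<open>g\<close> is continuous and \<open>g 0 = a \<ge> 0\<close>.\<close>

lemma integral_equation_lower_bound:
  fixes g h \<phi> :: "real \<Rightarrow> real"
  assumes h: "h integrable_on {0..T}" and \<phi>: "\<phi> integrable_on {0..T}"
    and g: "\<And>t. t \<in> {0..T} \<Longrightarrow> g t = a + integral {0..t} h"
    and a: "a \<ge> 0"
    and \<phi>_nonneg: "\<And>t. t \<in> {0..T} \<Longrightarrow> \<phi> t \<ge> 0"
    and lower: "\<And>t. t \<in> {0..T} \<Longrightarrow> g t < 0 \<Longrightarrow> - \<phi> t \<le> h t"
    and t: "t \<in> {0..T}"
  shows "- integral {0..t} \<phi> \<le> g t"
proof (cases "g t < 0")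
  case False
  have "integral {0..t} \<phi> \<ge> 0"
    using \<phi>_nonneg t by (intro integral_nonneg integrable_on_subinterval[OF \<phi>]) auto
  with False show ?thesis by linarith
next
  case neg: True
  have cont: "continuous_on {0..t} g"
  proof (rule continuous_on_eq)
    show "continuous_on {0..t} (\<lambda>s. a + integral {0..s} h)"
      using t by (intro continuous_intros indefinite_integral_continuous_1 integrable_on_subinterval[OF h]) auto
  qed (use g t in auto)
  define Z where "Z = {s \<in> {0..t}. g s \<ge> 0}"
  have "Z = {0..t} \<inter> g -` {0..}"
    by (auto simp: Z_def)
  then have "closed Z"
    using continuous_closed_preimage[OF cont, of "{0..}"] by simp
  then have "compact Z"
    by (simp add: compact_eq_bounded_closed)
      (auto simp: Z_def intro: bounded_subset[OF bounded_closed_interval[of 0 t]])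
  moreover have "0 \<in> Z"
    using t g[of 0] a by (auto simp: Z_def)
  ultimately obtain s where s: "s \<in> Z" and s_max: "\<And>r. r \<in> Z \<Longrightarrow> r \<le> s"
    using compact_attains_sup[of Z] by blast
  have st: "0 \<le> s" "s \<le> t" "g s \<ge> 0"
    using s by (auto simp: Z_def)
  have split: "integral {0..t} f = integral {0..s} f + integral {s..t} f" if "f integrable_on {0..T}" for f :: "real \<Rightarrow> real"
  proof -
    have "f integrable_on {0..t}"
      using t by (intro integrable_on_subinterval[OF that]) auto
    then show ?thesis
      using Henstock_Kurzweil_Integration.integral_combine[where a = 0 and c = s and b = t and f = f] st by simp
  qed
  have sub: "f integrable_on {r..t}" if "f integrable_on {0..T}" "0 \<le> r" for r and f :: "real \<Rightarrow> real"
    using t that by (intro integrable_on_subinterval[OF that(1)]) auto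
  have "- integral {0..t} \<phi> \<le> - integral {s..t} \<phi>"
  proof -
    have "integral {0..s} \<phi> \<ge> 0"
      using \<phi>_nonneg t st by (intro integral_nonneg integrable_on_subinterval[OF \<phi>]) auto
    then show ?thesis using split[OF \<phi>] by linarith
  qed
  also have "\<dots> = integral {s..t} (\<lambda>r. - \<phi> r)" by simp
  also have "\<dots> \<le> integral {s..t} h"
  proof -
    \<comment> \<open>The endpoint \<open>s\<close> has to go: there \<open>g s \<ge> 0\<close> and \<open>h s\<close> is uncontrolled.\<close>
    have "integral {s<..<t} (\<lambda>r. - \<phi> r) \<le> integral {s<..<t} h"
    proof (rule integral_le)
      show "(\<lambda>r. - \<phi> r) integrable_on {s<..<t}" "h integrable_on {s<..<t}"
        using sub[OF h st(1)] integrable_neg[OF sub[OF \<phi> st(1)]]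
        by (simp_all only: integrable_on_Icc_iff_Ioo)
      fix r assume r: "r \<in> {s<..<t}"
      then have "r \<notin> Z" using s_max by force
      then have "g r < 0" using r st by (auto simp: Z_def)
      then show "- \<phi> r \<le> h r" using lower r st t by auto
    qed
    then show ?thesis
      by (simp add: integral_open_interval_real)
  qed
  also have "\<dots> \<le> g t"
    using g[of t] g[of s] split[OF h] st t by auto
  finally show ?thesis .
qed

section \<open>Solutions of the nonlocal problem\<close>

text \<open>Continuity bounds the essential supremum near each time, and compactness of \<open>{0..T}\<close> (in the form of
the bisection principle \<open>Bolzano\<close>) makes the bound uniform.\<close>

lemma continuous_into_Linfty_AE_bounded:
  fixes u :: "real \<Rightarrow> 'a::euclidean_space \<Rightarrow> real"
  assumes u: "continuous_into_Linfty u" and T: "0 \<le> T"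
  shows "\<exists>C\<ge>0. \<forall>t\<in>{0..T}. AE x in lebesgue. \<bar>u t x\<bar> \<le> C"
proof -
  \<comment> \<open>Intervals around \<open>t = 0\<close> reach into negative times, which are cut away.\<close>
  define P where "P a b \<longleftrightarrow> (\<exists>C. \<forall>t\<in>{a..b} \<inter> {0..}. AE x in lebesgue. \<bar>u t x\<bar> \<le> C)" for a b :: real
  have "P 0 T"
  proof (rule Bolzano[OF T])
    fix a b c :: real assume "P a b" "P b c" "a \<le> b" "b \<le> c"
    then obtain C D where C: "\<And>t. t \<in> {a..b} \<inter> {0..} \<Longrightarrow> AE x in lebesgue. \<bar>u t x\<bar> \<le> C"
      and D: "\<And>t. t \<in> {b..c} \<inter> {0..} \<Longrightarrow> AE x in lebesgue. \<bar>u t x\<bar> \<le> D"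
      unfolding P_def by blast
    have "AE x in lebesgue. \<bar>u t x\<bar> \<le> max C D" if "t \<in> {a..c} \<inter> {0..}" for t
    proof (cases "t \<le> b")
      case True
      then have "AE x in lebesgue. \<bar>u t x\<bar> \<le> C" using that by (intro C) simp
      then show ?thesis by (rule eventually_mono) simp
    next
      case False
      then have "AE x in lebesgue. \<bar>u t x\<bar> \<le> D" using that by (intro D) simp
      then show ?thesis by (rule eventually_mono) simp
    qed
    then show "P a c" unfolding P_def by blast
  next
    fix t :: real assume t: "0 \<le> t" "t \<le> T"
    have "Linfty_norm (u t) < \<infinity>"
      using u t by (auto simp: continuous_into_Linfty_def in_Linfty_def)
    then obtain C :: real where C: "Linfty_norm (u t) \<le> ereal C"
      by (cases "Linfty_norm (u t)") auto
    have AEt: "AE x in lebesgue. \<bar>u t x\<bar> \<le> C"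
      using esssup_AE[of "\<lambda>x. ereal \<bar>u t x\<bar>" lebesgue]
    proof eventually_elim
      case (elim x)
      then have "ereal \<bar>u t x\<bar> \<le> ereal C"
        using C unfolding Linfty_norm_def by (rule order_trans)
      then show ?case by simp
    qed
    have "((\<lambda>s. Linfty_norm (\<lambda>x. u s x - u t x)) \<longlongrightarrow> 0) (at t within {0..})"
      using u t by (auto simp: continuous_into_Linfty_def)
    then have "eventually (\<lambda>s. Linfty_norm (\<lambda>x. u s x - u t x) < 1) (at t within {0..})"
      by (rule order_tendstoD) simp
    then obtain d where d: "d > 0"
      and near: "\<And>s. s \<ge> 0 \<Longrightarrow> s \<noteq> t \<Longrightarrow> dist s t < d \<Longrightarrow> Linfty_norm (\<lambda>x. u s x - u t x) < 1"
      by (auto simp: eventually_at)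
    have "AE x in lebesgue. \<bar>u s x\<bar> \<le> C + 1" if s: "s \<ge> 0" "dist s t < d" for s
    proof (cases "s = t")
      case True
      show ?thesis unfolding True using AEt by (rule eventually_mono) simp
    next
      case False
      have "AE x in lebesgue. ereal \<bar>u s x - u t x\<bar> \<le> Linfty_norm (\<lambda>x. u s x - u t x)"
        unfolding Linfty_norm_def by (rule esssup_AE)
      with AEt show ?thesis
      proof eventually_elim
        case (elim x)
        then have "ereal \<bar>u s x - u t x\<bar> < 1"
          using order_le_less_trans[OF _ near[OF s(1) False s(2)]] by blast
        then have "\<bar>u s x - u t x\<bar> < 1" by (simp add: one_ereal_def)
        with elim show ?case by linarith
      qed
    qed
    then have "P a b" if "a \<le> t" "t \<le> b" "b - a < d" for a b
      unfolding P_def using that by (intro exI[of _ "C + 1"] ballI) (simp add: dist_real_def abs_if)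
    then show "\<exists>d>0. \<forall>a b. a \<le> t \<and> t \<le> b \<and> b - a < d \<longrightarrow> P a b"
      using d by blast
  qed
  then obtain C where C: "\<And>t. t \<in> {0..T} \<Longrightarrow> AE x in lebesgue. \<bar>u t x\<bar> \<le> C"
    unfolding P_def by (metis IntI atLeastAtMost_iff atLeast_iff)
  have "AE x in lebesgue. \<bar>u t x\<bar> \<le> max C 0" if "t \<in> {0..T}" for t
    using C[OF that] by (rule eventually_mono) simp
  then show ?thesis
    by (intro exI[of _ "max C 0"] conjI ballI) simp_all
qed

locale nonlocal_problem =
  fixes d :: real and k \<gamma>0 :: "'a::euclidean_space \<Rightarrow> real" and \<gamma> :: "real \<Rightarrow> 'a \<Rightarrow> real"
  assumes d_pos: "d > 0"
    and k_integrable: "integrable lebesgue k"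
    and k_nonneg: "\<And>x. k x \<ge> 0"
    and k_mass: "(LINT x|lebesgue. k x) = 1"
    and k_decreasing: "\<And>x y. norm x \<le> norm y \<Longrightarrow> k y \<le> k x"
    and solution: "nonlocal_solution d k \<gamma>0 \<gamma>"
begin

definition gain :: "real \<Rightarrow> 'a \<Rightarrow> real" where
  "gain t x = (LINT y|lebesgue. k (x - y) * max 0 (\<gamma> t y))"

definition rate :: "real \<Rightarrow> 'a \<Rightarrow> real" where
  "rate t x = d * (gain t x - max 0 (\<gamma> t x))"

text \<open>Both integrals over \<open>{\<gamma> > 0}\<close> only see the positive part of \<open>\<gamma>\<close>, so each value \<open>\<gamma> t x\<close> solves a
scalar integral equation in time with right-hand side \<open>rate\<close>.\<close>

lemma solution_integral_equation:
  assumes "t \<ge> 0"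
  shows "(\<lambda>s. rate s x) integrable_on {0..t}"
    and "\<gamma> t x = \<gamma>0 x + integral {0..t} (\<lambda>s. rate s x)"
proof -
  have gain: "(LINT y:{y. \<gamma> s y > 0}|lebesgue. k (x - y) * \<gamma> s y) = gain s x" for s
    unfolding set_lebesgue_integral_def gain_def
    by (rule Bochner_Integration.integral_cong) (auto simp: indicator_def max_def)
  have loss: "\<gamma> s x * indicat_real {y. \<gamma> s y > 0} x = max 0 (\<gamma> s x)" for s
    by (cases "\<gamma> s x > 0") simp_all
  have gi: "set_integrable lebesgue {0..t} (\<lambda>s. gain s x)"
    and li: "set_integrable lebesgue {0..t} (\<lambda>s. max 0 (\<gamma> s x))"
    and eq: "\<gamma> t x = \<gamma>0 x + d * (LINT s:{0..t}|lebesgue. gain s x)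
                         - d * (LINT s:{0..t}|lebesgue. max 0 (\<gamma> s x))"
  proof -
    note this_x = solution[unfolded nonlocal_solution_def, THEN conjunct2, rule_format, OF assms, of x,
        unfolded gain loss]
    show "set_integrable lebesgue {0..t} (\<lambda>s. gain s x)"
      by (rule this_x[THEN conjunct1])
    show "set_integrable lebesgue {0..t} (\<lambda>s. max 0 (\<gamma> s x))"
      by (rule this_x[THEN conjunct2, THEN conjunct1])
    show "\<gamma> t x = \<gamma>0 x + d * (LINT s:{0..t}|lebesgue. gain s x)
                      - d * (LINT s:{0..t}|lebesgue. max 0 (\<gamma> s x))"
      by (rule this_x[THEN conjunct2, THEN conjunct2])
  qed
  note g = set_lebesgue_integral_eq_integral[OF gi] and l = set_lebesgue_integral_eq_integral[OF li]
  show "(\<lambda>s. rate s x) integrable_on {0..t}"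
    unfolding rate_def using integrable_diff[OF g(1) l(1)]
    by (rule integrable_on_mult_right)
  show "\<gamma> t x = \<gamma>0 x + integral {0..t} (\<lambda>s. rate s x)"
  proof -
    have "integral {0..t} (\<lambda>s. rate s x)
        = d * (integral {0..t} (\<lambda>s. gain s x) - integral {0..t} (\<lambda>s. max 0 (\<gamma> s x)))"
      unfolding rate_def integral_mult_right
      by (simp only: Henstock_Kurzweil_Integration.integral_diff[OF g(1) l(1)])
    then show ?thesis using eq by (simp add: g(2) l(2) right_diff_distrib)
  qed
qed

lemma solution_measurable: "t \<ge> 0 \<Longrightarrow> \<gamma> t \<in> borel_measurable lebesgue"
  using solution by (auto simp: nonlocal_solution_def continuous_into_Linfty_def in_Linfty_def)

lemma solution_AE_bounded:
  assumes "0 \<le> T"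
  shows "\<exists>C\<ge>0. \<forall>t\<in>{0..T}. AE x in lebesgue. \<bar>\<gamma> t x\<bar> \<le> C"
proof -
  have "continuous_into_Linfty \<gamma>"
    using solution by (simp add: nonlocal_solution_def)
  from continuous_into_Linfty_AE_bounded[OF this assms] show ?thesis .
qed

lemma positive_part:
  assumes "t \<ge> 0" and "AE x in lebesgue. \<bar>\<gamma> t x\<bar> \<le> C"
  shows "(\<lambda>y. max 0 (\<gamma> t y)) \<in> borel_measurable lebesgue"
    and "AE y in lebesgue. \<bar>max 0 (\<gamma> t y)\<bar> \<le> C"
proof -
  show "(\<lambda>y. max 0 (\<gamma> t y)) \<in> borel_measurable lebesgue"
    using solution_measurable[OF assms(1)] by (intro borel_measurable_max) auto
  show "AE y in lebesgue. \<bar>max 0 (\<gamma> t y)\<bar> \<le> C"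
    using assms(2) by (rule eventually_mono) auto
qed

lemma gain_nonneg: "gain t x \<ge> 0"
  unfolding gain_def by (rule integral_nonneg_AE) (simp add: k_nonneg)

lemma gain_le:
  assumes "t \<ge> 0" and C: "AE x in lebesgue. \<bar>\<gamma> t x\<bar> \<le> C"
  shows "gain t x \<le> C"
proof -
  note conv = integrable_convolution_integrand[OF k_integrable positive_part[OF assms]]
    and shift = lebesgue_integrable_reflect_point[OF k_integrable]
  have "gain t x \<le> (LINT y|lebesgue. k (x - y) * C)"
    unfolding gain_def
  proof (rule integral_mono_AE)
    show "AE y in lebesgue. k (x - y) * max 0 (\<gamma> t y) \<le> k (x - y) * C"
      using positive_part(2)[OF assms]
      by (rule eventually_mono) (intro mult_left_mono k_nonneg, linarith)
  qed (use conv shift in auto)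
  also have "\<dots> = C"
    by (simp add: lebesgue_integral_reflect_point[OF k_integrable] k_mass)
  finally show ?thesis .
qed

text \<open>Below \<open>m \<le> 0\<close> the loss term is switched off and only the nonnegative gain remains. With \<open>m = 0\<close> this
says that a point which starts nonnegative stays so; in general it bounds \<open>\<gamma>\<close> from below at every
point, not only almost everywhere.\<close>

lemma solution_ge:
  assumes "m \<le> 0" and "m \<le> \<gamma>0 x" and "t \<ge> 0"
  shows "m \<le> \<gamma> t x"
proof -
  have "- integral {0..t} (\<lambda>_. 0) \<le> \<gamma> t x - m"
  proof (rule integral_equation_lower_bound[where h = "\<lambda>s. rate s x" and a = "\<gamma>0 x - m" and T = t])
    fix s assume "s \<in> {0..t}" "\<gamma> s x - m < 0"
    then have "rate s x = d * gain s x"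
      using assms by (simp add: rate_def)
    then show "- 0 \<le> rate s x"
      using d_pos gain_nonneg by simp
  qed (use assms solution_integral_equation in auto)
  then show ?thesis by simp
qed

lemma solution_le:
  assumes "\<And>x. \<gamma>0 x \<le> G" and "T \<ge> 0"
  shows "\<exists>M. \<forall>t\<in>{0..T}. \<forall>x. \<gamma> t x \<le> M"
proof -
  obtain C where C: "C \<ge> 0" "\<And>t. t \<in> {0..T} \<Longrightarrow> AE x in lebesgue. \<bar>\<gamma> t x\<bar> \<le> C"
    using solution_AE_bounded[OF assms(2)] by blast
  have "\<gamma> t x \<le> G + d * C * T" if t: "t \<in> {0..T}" for t x
  proof -
    have "integral {0..t} (\<lambda>s. rate s x) \<le> integral {0..t} (\<lambda>_. d * C)"
    proof (rule integral_le)
      fix s assume s: "s \<in> {0..t}"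
      then have "gain s x \<le> C" using t by (intro gain_le C(2)) auto
      then have "gain s x - max 0 (\<gamma> s x) \<le> C" by linarith
      then show "rate s x \<le> d * C"
        unfolding rate_def using d_pos by (intro mult_left_mono) auto
    qed (use solution_integral_equation(1) t in auto)
    also have "\<dots> = d * C * t"
      using t by simp
    also have "\<dots> \<le> d * C * T"
      using t C(1) d_pos by (intro mult_left_mono) auto
    finally show ?thesis
      using solution_integral_equation(2)[of t x] assms(1)[of x] t by auto
  qed
  then show ?thesis by blast
qed

text \<open>Where \<open>w t z = \<gamma> t z - \<gamma> t (R z)\<close> is negative, its growth rate is at least
\<open>- d N exp (2 d t)\<close>: the gain terms contribute this much by
\<open>reflected_convolution_lower_bound\<close>, and the loss terms help because \<open>\<gamma> t z < \<gamma> t (R z)\<close>.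
The exponent \<open>2 d\<close> is chosen so that integrating in time yields the factor \<open>1/2\<close>.\<close>

lemma reflection_defect_halving:
  assumes e: "norm e = 1"
    and initial: "\<And>z. z \<bullet> e < c \<Longrightarrow> \<gamma>0 (hyperplane_reflection e c z) \<le> \<gamma>0 z"
    and N: "N \<ge> 0"
    and defect: "\<And>t z. t \<in> {0..T} \<Longrightarrow> z \<bullet> e < c \<Longrightarrow>
                   - (N * exp (2 * d * t)) \<le> \<gamma> t z - \<gamma> t (hyperplane_reflection e c z)"
    and t: "t \<in> {0..T}" and z: "z \<bullet> e < c"
  shows "- (N / 2 * exp (2 * d * t)) \<le> \<gamma> t z - \<gamma> t (hyperplane_reflection e c z)"
proof -
  let ?R = "hyperplane_reflection e c"
  have T: "0 \<le> T" using t by auto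
  obtain C where C: "\<And>s. s \<in> {0..T} \<Longrightarrow> AE x in lebesgue. \<bar>\<gamma> s x\<bar> \<le> C"
    using solution_AE_bounded[OF T] by blast
  have \<phi>: "((\<lambda>s. d * N * exp (2 * d * s)) has_integral N / 2 * exp (2 * d * t) - N / 2 * exp (2 * d * 0)) {0..t}"
    if "0 \<le> t" for t
    using that
    by (intro fundamental_theorem_of_calculus)
      (auto intro!: derivative_eq_intros simp flip: has_real_derivative_iff_has_vector_derivative)
  have "- integral {0..t} (\<lambda>s. d * N * exp (2 * d * s)) \<le> \<gamma> t z - \<gamma> t (?R z)"
  proof (rule integral_equation_lower_bound[where h = "\<lambda>s. rate s z - rate s (?R z)" and a = "\<gamma>0 z - \<gamma>0 (?R z)"])
    show "(\<lambda>s. rate s z - rate s (?R z)) integrable_on {0..T}"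
      using T by (intro integrable_diff solution_integral_equation)
    show "(\<lambda>s. d * N * exp (2 * d * s)) integrable_on {0..T}"
      using \<phi>[OF T] by blast
    show "\<gamma> s z - \<gamma> s (?R z) = \<gamma>0 z - \<gamma>0 (?R z) + integral {0..s} (\<lambda>s. rate s z - rate s (?R z))"
      if "s \<in> {0..T}" for s
      using that solution_integral_equation[of s z] solution_integral_equation[of s "?R z"]
      by (simp add: Henstock_Kurzweil_Integration.integral_diff)
    show "0 \<le> \<gamma>0 z - \<gamma>0 (?R z)" using initial[OF z] by simp
    show "0 \<le> d * N * exp (2 * d * s)" for s
      using d_pos N by simp
    show "t \<in> {0..T}" by (rule t)
    fix s assume s: "s \<in> {0..T}" and neg: "\<gamma> s z - \<gamma> s (?R z) < 0"
    have s0: "s \<ge> 0" using s by simp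
    have "- (N * exp (2 * d * s)) \<le> gain s z - gain s (?R z)"
      unfolding gain_def
    proof (rule reflected_convolution_lower_bound[OF k_integrable k_nonneg k_mass k_decreasing
            positive_part[OF s0 C[OF s]] e _ _ z])
      show "0 \<le> N * exp (2 * d * s)" using N by simp
      show "- (N * exp (2 * d * s)) \<le> max 0 (\<gamma> s y) - max 0 (\<gamma> s (?R y))" if "y \<bullet> e < c" for y
      proof -
        have "0 \<le> N * exp (2 * d * s)" using N by simp
        then show ?thesis using defect[OF s that] by linarith
      qed
    qed
    moreover have "max 0 (\<gamma> s z) \<le> max 0 (\<gamma> s (?R z))" using neg by linarith
    ultimately have "- (N * exp (2 * d * s)) \<le> (gain s z - max 0 (\<gamma> s z)) - (gain s (?R z) - max 0 (\<gamma> s (?R z)))"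
      by linarith
    then have "d * - (N * exp (2 * d * s))
        \<le> d * ((gain s z - max 0 (\<gamma> s z)) - (gain s (?R z) - max 0 (\<gamma> s (?R z))))"
      using d_pos by (intro mult_left_mono) auto
    then show "- (d * N * exp (2 * d * s)) \<le> rate s z - rate s (?R z)"
      by (simp add: rate_def right_diff_distrib)
  qed
  moreover have "integral {0..t} (\<lambda>s. d * N * exp (2 * d * s)) = N / 2 * exp (2 * d * t) - N / 2"
    using integral_unique[OF \<phi>[of t]] t by simp
  ultimately show ?thesis using N by linarith
qed

text \<open>The pointwise bounds on \<open>\<gamma>\<close> over \<open>{0..t}\<close> give some finite defect \<open>N\<close> to start from; halving it
repeatedly leaves none.\<close>

lemma reflection_comparison:
  assumes e: "norm e = 1"
    and lower: "\<And>x. m \<le> \<gamma>0 x" and upper: "\<And>x. \<gamma>0 x \<le> G"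
    and initial: "\<And>z. z \<bullet> e < c \<Longrightarrow> \<gamma>0 (hyperplane_reflection e c z) \<le> \<gamma>0 z"
    and t: "t \<ge> 0" and z: "z \<bullet> e < c"
  shows "\<gamma> t (hyperplane_reflection e c z) \<le> \<gamma> t z"
proof -
  let ?R = "hyperplane_reflection e c"
  obtain M where M: "\<And>s x. s \<in> {0..t} \<Longrightarrow> \<gamma> s x \<le> M"
    using solution_le[OF upper t] by blast
  define N where "N = max 0 (M - min m 0)"
  have base: "- (N * exp (2 * d * s)) \<le> \<gamma> s x - \<gamma> s (?R x)" if s: "s \<in> {0..t}" for s x
  proof -
    have "N * 1 \<le> N * exp (2 * d * s)"
      using s d_pos by (intro mult_left_mono) (auto simp: N_def)
    moreover have "min m 0 \<le> \<gamma> s x"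
      using lower[of x] s by (intro solution_ge) auto
    moreover have "M - min m 0 \<le> N" by (simp add: N_def)
    ultimately show ?thesis using M[OF s, of "?R x"] by linarith
  qed
  have iter: "\<forall>s\<in>{0..t}. \<forall>x. x \<bullet> e < c \<longrightarrow> - (N / 2 ^ j * exp (2 * d * s)) \<le> \<gamma> s x - \<gamma> s (?R x)" for j
  proof (induction j)
    case 0
    then show ?case using base by simp
  next
    case (Suc j)
    have "N / 2 ^ j \<ge> 0" by (simp add: N_def)
    then show ?case
      using reflection_defect_halving[OF e initial, of "N / 2 ^ j" t] Suc
      by (simp add: mult.commute)
  qed
  have "(\<lambda>j. - (N / 2 ^ j * exp (2 * d * t))) \<longlonglongrightarrow> - (0 * exp (2 * d * t))"
    by (intro tendsto_intros LIMSEQ_divide_realpow_zero) simp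
  then have "- (0 * exp (2 * d * t)) \<le> \<gamma> t z - \<gamma> t (?R z)"
    by (rule LIMSEQ_le_const2) (use iter t z in auto)
  then show ?thesis by simp
qed

end

section \<open>Geometry\<close>

text \<open>The hyperplane is the perpendicular bisector of \<open>y\<close> and \<open>x\<close>. It is orthogonal to \<open>x - p\<close> with \<open>p\<close>
the closest point, and it lies beyond \<open>y\<close> as seen from \<open>p\<close>, whereas \<open>S\<close> lies behind the supporting
hyperplane at \<open>p\<close> with the same normal.\<close>

lemma reflection_separating_from_convex:
  fixes S :: "'a::euclidean_space set"
  assumes "convex S" "closed S"
    and y: "y \<in> closed_segment (closest_point S x) x" and "y \<noteq> x"
  obtains e c where "norm e = 1" and "y \<bullet> e < c" and "hyperplane_reflection e c y = x"
    and "\<And>z. z \<in> S \<Longrightarrow> z \<bullet> e < c"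
proof -
  let ?p = "closest_point S x"
  obtain s where s: "0 \<le> s" "s \<le> 1" and y_eq: "y = (1 - s) *\<^sub>R ?p + s *\<^sub>R x"
    using y by (auto simp: in_segment)
  have "s \<noteq> 1" using y_eq \<open>y \<noteq> x\<close> by auto
  then have s1: "1 - s > 0" using s by simp
  have xy: "x - y = (1 - s) *\<^sub>R (x - ?p)" and yp: "y - ?p = s *\<^sub>R (x - ?p)"
    unfolding y_eq by (simp_all add: algebra_simps)
  define r where "r = norm (x - y)"
  define e where "e = (x - y) /\<^sub>R r"
  define c where "c = (x + y) \<bullet> e / 2"
  have r: "r > 0" using \<open>y \<noteq> x\<close> by (simp add: r_def)
  have re: "r *\<^sub>R e = x - y" using r by (simp add: e_def)
  have ne: "norm e = 1" using r by (simp add: e_def r_def)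
  have "(x - y) \<bullet> e = r" using ne by (simp flip: re add: norm_eq_1)
  then have xe: "x \<bullet> e = y \<bullet> e + r" by (simp add: inner_diff_left)
  then have c: "c = y \<bullet> e + r / 2" by (simp add: c_def inner_add_left)
  have R: "hyperplane_reflection e c y = x"
    using re by (simp add: hyperplane_reflection_def c)
  have "z \<bullet> e < c" if "z \<in> S" for z
  proof -
    have "(z - ?p) \<bullet> (x - ?p) \<le> 0"
      using closest_point_dot[OF assms(1,2) that, of x] by (simp add: inner_commute)
    moreover have "(z - y) \<bullet> (x - ?p) = (z - ?p) \<bullet> (x - ?p) - (y - ?p) \<bullet> (x - ?p)"
      by (simp flip: inner_diff_left)
    moreover have "(y - ?p) \<bullet> (x - ?p) \<ge> 0"
      using s by (simp add: yp)
    ultimately have "(z - y) \<bullet> (x - ?p) \<le> 0" by linarith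
    then have "(z - y) \<bullet> e \<le> 0"
      using s1 r by (simp add: e_def xy mult_le_0_iff divide_le_0_iff zero_le_mult_iff)
    then show ?thesis using c r by (simp add: inner_diff_left)
  qed
  then show ?thesis using that[of e c] ne R c r by simp
qed

lemma connected_if_segments_to_connected_subset:
  fixes A C :: "'a::real_normed_vector set"
  assumes C: "connected C" "C \<subseteq> A"
    and p: "\<And>x. x \<in> A \<Longrightarrow> p x \<in> C" and seg: "\<And>x. x \<in> A \<Longrightarrow> closed_segment (p x) x \<subseteq> A"
  shows "connected A"
proof (cases "A = {}")
  case False
  have "connected (\<Union>x\<in>A. C \<union> closed_segment (p x) x)"
  proof (rule connected_Union)
    fix B assume "B \<in> (\<lambda>x. C \<union> closed_segment (p x) x) ` A"
    then obtain x where x: "x \<in> A" and B: "B = C \<union> closed_segment (p x) x" by blast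
    show "connected B"
      unfolding B using p[OF x] by (intro connected_Un C connected_segment) auto
  next
    show "\<Inter> ((\<lambda>x. C \<union> closed_segment (p x) x) ` A) \<noteq> {}"
      using False p by blast
  qed
  also have "(\<Union>x\<in>A. C \<union> closed_segment (p x) x) = A"
    using C seg by fastforce
  finally show ?thesis .
qed simp

section \<open>The nonnegativity set stays connected\<close>

theorem theorem3p2:
  fixes d l0 :: real
    and k \<gamma>0 :: "real ^ 'n \<Rightarrow> real"
    and \<Omega>0 :: "(real ^ 'n) set"
    and \<gamma> :: "real \<Rightarrow> real ^ 'n \<Rightarrow> real"
  assumes "d > 0"
    and "continuous_on UNIV k" and "in_Linfty k"
    and "\<And>x. k x \<ge> 0" and "k 0 > 0"
    and "integrable lebesgue k" and "(LINT x|lebesgue. k x) = 1"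
    and k_radial: "\<And>x y. norm x = norm y \<Longrightarrow> k x = k y"
    and k_decreasing: "\<And>x y. norm x \<le> norm y \<Longrightarrow> k y \<le> k x"
    and "smooth_bounded_domain \<Omega>0" and "convex (closure \<Omega>0)"
    and "l0 > 0"
    and "in_Linfty \<gamma>0"
    and "\<And>x. x \<notin> closure \<Omega>0 \<Longrightarrow> \<gamma>0 x = - l0"
    and "\<And>x. x \<in> closure \<Omega>0 \<Longrightarrow> \<gamma>0 x \<ge> 0"
    and "\<exists>x\<in>closure \<Omega>0. \<gamma>0 x \<noteq> 0"
    and "continuous_on (closure \<Omega>0) \<gamma>0"
    and "nonlocal_solution d k \<gamma>0 \<gamma>"
  shows "\<forall>t\<ge>0. connected {x. \<gamma> t x \<ge> 0}"
proof (intro allI impI)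
  fix t :: real assume t: "t \<ge> 0"
  let ?C = "closure \<Omega>0"
  interpret nonlocal_problem d k \<gamma>0 \<gamma>
    by unfold_locales (fact assms)+
  have C: "convex ?C" "closed ?C" "?C \<noteq> {}" "compact ?C"
    using assms(10,11) by (auto simp: smooth_bounded_domain_def)
  have outside: "\<And>x. x \<notin> ?C \<Longrightarrow> \<gamma>0 x = - l0" and inside: "\<And>x. x \<in> ?C \<Longrightarrow> 0 \<le> \<gamma>0 x"
    by fact+
  have lower: "- l0 \<le> \<gamma>0 x" for x
    using inside[of x] outside[of x] \<open>l0 > 0\<close> by (cases "x \<in> ?C") auto
  obtain G where G: "\<And>x. x \<in> ?C \<Longrightarrow> \<gamma>0 x \<le> G"
    using continuous_attains_sup[OF C(4,3) \<open>continuous_on ?C \<gamma>0\<close>] by blast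
  have upper: "\<gamma>0 x \<le> max G 0" for x
    using G[of x] outside[of x] \<open>l0 > 0\<close> by (cases "x \<in> ?C") auto
  have C_subset: "?C \<subseteq> {x. \<gamma> t x \<ge> 0}"
    using solution_ge[of 0] inside t by blast
  show "connected {x. \<gamma> t x \<ge> 0}"
  proof (rule connected_if_segments_to_connected_subset[OF convex_connected[OF C(1)] C_subset])
    fix x assume x: "x \<in> {x. \<gamma> t x \<ge> 0}"
    show "closest_point ?C x \<in> ?C"
      using C by (intro closest_point_in_set)
    show "closed_segment (closest_point ?C x) x \<subseteq> {x. \<gamma> t x \<ge> 0}"
    proof
      fix y assume y: "y \<in> closed_segment (closest_point ?C x) x"
      show "y \<in> {x. \<gamma> t x \<ge> 0}"
      proof (cases "y = x")
        case False
        then obtain e c where e: "norm e = 1" and yc: "y \<bullet> e < c"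
          and Ry: "hyperplane_reflection e c y = x" and sep: "\<And>z. z \<in> ?C \<Longrightarrow> z \<bullet> e < c"
          using reflection_separating_from_convex[OF C(1,2) y] by blast
        \<comment> \<open>Mirror images of points on the near side lie outside \<open>closure \<Omega>0\<close>, and there \<open>\<gamma>0\<close> is minimal.\<close>
        have "\<gamma>0 (hyperplane_reflection e c z) \<le> \<gamma>0 z" if "z \<bullet> e < c" for z
        proof -
          have "hyperplane_reflection e c z \<notin> ?C"
            using sep[of "hyperplane_reflection e c z"] that inner_hyperplane_reflection[OF e, of c z]
            by auto
          then show ?thesis using outside lower by simp
        qed
        from reflection_comparison[OF e lower upper this t yc] show ?thesis
          using x by (simp add: Ry)
      qed (use x in simp)
    qed
  qed
qed

end
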